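(* Given a path $P$ with a weight function $w\colon V(P)\to\mathbb{N}$, a treedepth decomposition of $P$ of minimum weighted depth can be computed in time $\mathcal{O}(|P|^3)$ (assuming arithmetic operations take constant time).
   Context: $\mathbb{N}$ denotes the positive integers. A treedepth decomposition of a graph $G$ is a rooted forest $F$ with $V(F)=V(G)$ such that for every edge $uv\in E(G)$, $u$ is an ancestor of $v$ in $F$ or $v$ is an ancestor of $u$ in $F$. The weighted depth of a treedepth decomposition is the maximum, over all paths from a root to a leaf of the same tree of $F$, of the sum of the weights of the vertices on the path. A decomposition is optimal if its weighted depth is minimum among all treedepth decompositions of the graph. Here $|P|$ denotes the number of vertices of $P$. *)

theory Defs
  imports Complex_Main "HOL-Library.Landau_Symbols"
begin

section \<open>Paths and treedepth decompositions\<close>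

text \<open>A simple graph is given by its vertex set \<open>V\<close> and its set \<open>E\<close> of two-element edges.\<close>

definition path_graph :: "'a set \<Rightarrow> 'a set set \<Rightarrow> bool" where
  "path_graph V E \<longleftrightarrow>
     (\<exists>vs. vs \<noteq> [] \<and> distinct vs \<and> V = set vs \<and>
           E = {{vs ! i, vs ! Suc i} | i. Suc i < length vs})"

text \<open>A rooted forest on \<open>V\<close> is given by its partial parent function; the roots are the vertices
  without a parent.\<close>

definition rooted_forest :: "'a set \<Rightarrow> ('a \<rightharpoonup> 'a) \<Rightarrow> bool" where
  "rooted_forest V par \<longleftrightarrow>
     finite V \<and> dom par \<subseteq> V \<and> ran par \<subseteq> V \<and> acyclic {(p, v). par v = Some p}"

definition ancestor :: "('a \<rightharpoonup> 'a) \<Rightarrow> 'a \<Rightarrow> 'a \<Rightarrow> bool" where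
  "ancestor par u v \<longleftrightarrow> (u, v) \<in> {(p, v). par v = Some p}\<^sup>+"

definition treedepth_decomposition :: "'a set \<Rightarrow> 'a set set \<Rightarrow> ('a \<rightharpoonup> 'a) \<Rightarrow> bool" where
  "treedepth_decomposition V E par \<longleftrightarrow>
     rooted_forest V par \<and>
     (\<forall>u v. {u, v} \<in> E \<longrightarrow> ancestor par u v \<or> ancestor par v u)"

definition root_leaf_path :: "'a set \<Rightarrow> ('a \<rightharpoonup> 'a) \<Rightarrow> 'a list \<Rightarrow> bool" where
  "root_leaf_path V par xs \<longleftrightarrow>
     xs \<noteq> [] \<and> set xs \<subseteq> V \<and> par (hd xs) = None \<and>
     successively (\<lambda>p v. par v = Some p) xs \<and>
     (\<forall>v. par v \<noteq> Some (last xs))"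

definition weighted_depth :: "'a set \<Rightarrow> ('a \<Rightarrow> nat) \<Rightarrow> ('a \<rightharpoonup> 'a) \<Rightarrow> nat" where
  "weighted_depth V w par = Max {sum_list (map w xs) | xs. root_leaf_path V par xs}"

definition optimal_decomposition ::
    "'a set \<Rightarrow> 'a set set \<Rightarrow> ('a \<Rightarrow> nat) \<Rightarrow> ('a \<rightharpoonup> 'a) \<Rightarrow> bool" where
  "optimal_decomposition V E w par \<longleftrightarrow>
     treedepth_decomposition V E par \<and>
     (\<forall>par'. treedepth_decomposition V E par' \<longrightarrow>
        weighted_depth V w par \<le> weighted_depth V w par')"


section \<open>A unit-cost machine model\<close>

text \<open>
  Algorithms are programs of a small structured language over registers and one-dimensional
  arrays that hold natural numbers of any size.  A program mentions only finitely many registers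
  and arrays, so this is a structured form of the unit-cost random access machine.  Every
  constant, register access, array access, addition, subtraction, comparison, connective and
  control step costs one unit.  There is deliberately no multiplication and no bit operation: with
  numbers of unbounded size, charging one unit for those would make the machine unreasonably
  strong.
\<close>

type_synonym name = string

datatype aexp =
    Const nat
  | Var name
  | Read name aexp    \<comment> \<open>array name and index\<close>
  | Add aexp aexp
  | Sub aexp aexp     \<comment> \<open>truncated at zero\<close>

datatype bexp =
    Less aexp aexp
  | Equal aexp aexp
  | Neg bexp
  | And bexp bexp

datatype com =
    Skip
  | Assign name aexp
  | Write name aexp aexp    \<comment> \<open>array name, index, value\<close>
  | Seq com com
  | Cond bexp com com
  | While bexp com

record state =
  reg :: "name \<Rightarrow> nat"
  arr :: "name \<Rightarrow> nat \<Rightarrow> nat"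

fun aval :: "aexp \<Rightarrow> state \<Rightarrow> nat" where
  "aval (Const k) s = k"
| "aval (Var x) s = reg s x"
| "aval (Read A a) s = arr s A (aval a s)"
| "aval (Add a b) s = aval a s + aval b s"
| "aval (Sub a b) s = aval a s - aval b s"

fun bval :: "bexp \<Rightarrow> state \<Rightarrow> bool" where
  "bval (Less a b) s \<longleftrightarrow> aval a s < aval b s"
| "bval (Equal a b) s \<longleftrightarrow> aval a s = aval b s"
| "bval (Neg b) s \<longleftrightarrow> \<not> bval b s"
| "bval (And b c) s \<longleftrightarrow> bval b s \<and> bval c s"

fun acost :: "aexp \<Rightarrow> nat" where
  "acost (Const k) = 1"
| "acost (Var x) = 1"
| "acost (Read A a) = 1 + acost a"
| "acost (Add a b) = 1 + acost a + acost b"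
| "acost (Sub a b) = 1 + acost a + acost b"

fun bcost :: "bexp \<Rightarrow> nat" where
  "bcost (Less a b) = 1 + acost a + acost b"
| "bcost (Equal a b) = 1 + acost a + acost b"
| "bcost (Neg b) = 1 + bcost b"
| "bcost (And b c) = 1 + bcost b + bcost c"

text \<open>\<open>exec c s t s'\<close>: started in \<open>s\<close>, program \<open>c\<close> halts in \<open>s'\<close> after exactly \<open>t\<close> units of time.\<close>

inductive exec :: "com \<Rightarrow> state \<Rightarrow> nat \<Rightarrow> state \<Rightarrow> bool" where
  Skip: "exec Skip s 1 s"
| Assign: "exec (Assign x a) s (1 + acost a) (s\<lparr>reg := (reg s)(x := aval a s)\<rparr>)"
| Write: "exec (Write A i a) s (1 + acost i + acost a)
            (s\<lparr>arr := (arr s)(A := (arr s A)(aval i s := aval a s))\<rparr>)"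
| Seq: "exec c s t s' \<Longrightarrow> exec d s' u s'' \<Longrightarrow> exec (Seq c d) s (t + u) s''"
| CondTrue: "bval b s \<Longrightarrow> exec c s t s' \<Longrightarrow> exec (Cond b c d) s (1 + bcost b + t) s'"
| CondFalse: "\<not> bval b s \<Longrightarrow> exec d s t s' \<Longrightarrow> exec (Cond b c d) s (1 + bcost b + t) s'"
| WhileFalse: "\<not> bval b s \<Longrightarrow> exec (While b c) s (1 + bcost b) s"
| WhileTrue: "bval b s \<Longrightarrow> exec c s t s' \<Longrightarrow> exec (While b c) s' u s'' \<Longrightarrow>
    exec (While b c) s (1 + bcost b + t + u) s''"

inductive_cases exec_SkipE: "exec Skip s t s'"
inductive_cases exec_AssignE: "exec (Assign x a) s t s'"
inductive_cases exec_WriteE: "exec (Write A i a) s t s'"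
inductive_cases exec_SeqE: "exec (Seq c d) s t s'"
inductive_cases exec_CondE: "exec (Cond b c d) s t s'"
inductive_cases exec_WhileE: "exec (While b c) s t s'"

text \<open>The machine is deterministic, so ``some execution'' below always means ``the execution''.\<close>

lemma exec_deterministic:
  "exec c s t s' \<Longrightarrow> exec c s u r \<Longrightarrow> t = u \<and> s' = r"
proof (induction arbitrary: u r rule: exec.induct)
  case (Skip s)
  then show ?case by (elim exec_SkipE) simp
next
  case (Assign x a s)
  then show ?case by (elim exec_AssignE) simp
next
  case (Write A i a s)
  then show ?case by (elim exec_WriteE) simp
next
  case (Seq c s t s' d v s'')
  from Seq.prems obtain t1 t2 s1 where "u = t1 + t2" "exec c s t1 s1" "exec d s1 t2 r"
    by (elim exec_SeqE)
  with Seq.IH show ?case by metis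
next
  case (CondTrue b s c t s' d)
  from CondTrue.prems CondTrue.hyps obtain t1 where "u = 1 + bcost b + t1" "exec c s t1 r"
    by (elim exec_CondE) simp_all
  with CondTrue.IH show ?case by metis
next
  case (CondFalse b s d t s' c)
  from CondFalse.prems CondFalse.hyps obtain t1 where "u = 1 + bcost b + t1" "exec d s t1 r"
    by (elim exec_CondE) simp_all
  with CondFalse.IH show ?case by metis
next
  case (WhileFalse b s c)
  from WhileFalse.prems show ?case
    by (rule exec_WhileE) (use WhileFalse.hyps in simp_all)
next
  case (WhileTrue b s c t s' v s'')
  from WhileTrue.prems obtain t1 t2 s1
    where "u = 1 + bcost b + t1 + t2" "exec c s t1 s1" "exec (While b c) s1 t2 r"
    by (rule exec_WhileE) (use WhileTrue.hyps in simp_all)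
  with WhileTrue.IH show ?case by metis
qed


section \<open>Input and output conventions\<close>

text \<open>
  An input graph has vertices \<open>0, \<dots>, n - 1\<close> and is presented by a list of its edges, each edge
  once, in any order and any orientation.  In particular the numbering of the vertices of a path
  need not follow the path.
\<close>

definition edge_list :: "(nat \<times> nat) list \<Rightarrow> nat set set \<Rightarrow> bool" where
  "edge_list es E \<longleftrightarrow>
     distinct (map (\<lambda>(u, v). {u, v}) es) \<and> set (map (\<lambda>(u, v). {u, v}) es) = E"

definition load :: "nat list \<Rightarrow> nat \<Rightarrow> nat" where
  "load xs i = (if i < length xs then xs ! i else 0)"

definition input :: "nat \<Rightarrow> (nat \<times> nat) list \<Rightarrow> (nat \<Rightarrow> nat) \<Rightarrow> state" where
  "input n es w =
     \<lparr> reg = (\<lambda>_. 0)(''vertices'' := n, ''edges'' := length es),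
       arr = (\<lambda>_ _. 0)(''weight'' := load (map w [0..<n]),
                       ''tail'' := load (map fst es),
                       ''head'' := load (map snd es)) \<rparr>"

text \<open>On output the array \<open>parent\<close> holds the parent of every vertex; a root is marked by being its
  own parent.\<close>

definition output_forest :: "nat \<Rightarrow> state \<Rightarrow> (nat \<rightharpoonup> nat)" where
  "output_forest n s v =
     (if v < n \<and> arr s ''parent'' v \<noteq> v then Some (arr s ''parent'' v) else None)"

end

theory Submission
  imports Defs "HOL-Real_Asymp.Real_Asymp"
begin

text \<open>
  Among the vertices of a subpath, one is an ancestor of all the others in any treedepth
  decomposition of the path, because the ends of an edge are comparable and the ancestors of a
  vertex form a chain.  Deleting this vertex splits the subpath in two, so the optimum for the
  interval \<open>{i..<j}\<close> of positions satisfies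
  \<open>D i j = min\<^sub>k (x k + max (D i k) (D (k + 1) j))\<close>, where \<open>x k\<close> is the weight of the vertex at position
  \<open>k\<close>.  The program first recovers the order of the vertices along the path and then tabulates \<open>D\<close> by
  increasing length of the interval, together with a minimizing \<open>k\<close> for every interval.  The parent of a
  position in the resulting decomposition is the last position met before it when one
  searches for it by repeatedly splitting the whole path at the recorded \<open>k\<close>.
\<close>

section \<open>Rooted forests\<close>

abbreviation parent_rel :: "('a \<rightharpoonup> 'a) \<Rightarrow> ('a \<times> 'a) set" where
  "parent_rel par \<equiv> {(p, v). par v = Some p}"

text \<open>Every vertex has at most one parent, so walking upwards from \<open>c\<close> is
  deterministic and the two walks, to \<open>a\<close> and to \<open>b\<close>, cannot
  branch.\<close>

lemma parent_rel_comparable: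
  assumes "(a, c) \<in> (parent_rel par)\<^sup>*" "(b, c) \<in> (parent_rel par)\<^sup>*"
  shows "(a, b) \<in> (parent_rel par)\<^sup>* \<or> (b, a) \<in> (parent_rel par)\<^sup>*"
proof -
  have "single_valued ((parent_rel par)\<inverse>)"
    by (auto simp: single_valued_def)
  from single_valued_confluent[OF this, of c a b] assms show ?thesis
    by (auto simp: rtrancl_converse)
qed

lemma finite_parent_rel:
  assumes "rooted_forest V par" shows "finite (parent_rel par)"
proof (rule finite_subset)
  show "parent_rel par \<subseteq> V \<times> V"
    using assms by (auto simp: rooted_forest_def ran_def dom_def)
  show "finite (V \<times> V)" using assms by (simp add: rooted_forest_def)
qed

text \<open>All ancestors of \<open>v\<close> are collected on one path from a root, by induction
  from parents to children. Together with \<open>extend_to_leaf\<close> this compares the weight of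
  an ancestor set with the weighted depth.\<close>

lemma root_path_exists:
  assumes "rooted_forest V par" "v \<in> V"
  shows "\<exists>xs. xs \<noteq> [] \<and> last xs = v \<and> set xs \<subseteq> V \<and> {u. (u, v) \<in> (parent_rel par)\<^sup>*} \<subseteq> set xs \<and>
    par (hd xs) = None \<and> successively (\<lambda>p v. par v = Some p) xs"
proof -
  have "wf (parent_rel par)"
    using assms finite_parent_rel by (intro finite_acyclic_wf) (auto simp: rooted_forest_def)
  then show ?thesis using assms(2)
  proof (induction v rule: wf_induct_rule)
    case (less v)
    show ?case
    proof (cases "par v")
      case None
      then have "{u. (u, v) \<in> (parent_rel par)\<^sup>*} \<subseteq> set [v]"
        by (auto elim: rtranclE)
      with None less.prems show ?thesis by (intro exI[of _ "[v]"]) auto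
    next
      case (Some p)
      then have "p \<in> V" using assms(1) by (auto simp: rooted_forest_def ran_def)
      with less.IH Some obtain xs where xs: "xs \<noteq> []" "last xs = p" "set xs \<subseteq> V"
        "{u. (u, p) \<in> (parent_rel par)\<^sup>*} \<subseteq> set xs" "par (hd xs) = None"
        "successively (\<lambda>p v. par v = Some p) xs" by blast
      have "{u. (u, v) \<in> (parent_rel par)\<^sup>*} \<subseteq> set (xs @ [v])"
      proof
        fix u assume "u \<in> {u. (u, v) \<in> (parent_rel par)\<^sup>*}"
        then have "(u, v) \<in> (parent_rel par)\<^sup>*" by simp
        then show "u \<in> set (xs @ [v])"
          by (rule rtranclE) (use xs(4) Some in auto)
      qed
      with xs Some less.prems show ?thesis
        by (intro exI[of _ "xs @ [v]"]) (auto simp: successively_append_iff)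
    qed
  qed
qed

lemma extend_to_leaf:
  assumes "rooted_forest V par" "xs \<noteq> []" "set xs \<subseteq> V" "par (hd xs) = None"
    "successively (\<lambda>p v. par v = Some p) xs"
  shows "\<exists>ys. root_leaf_path V par ys \<and> set xs \<subseteq> set ys"
proof -
  have "wf ((parent_rel par)\<inverse>)"
    using assms finite_parent_rel by (intro finite_acyclic_wf_converse) (auto simp: rooted_forest_def)
  then show ?thesis using assms(2-)
  proof (induction "last xs" arbitrary: xs rule: wf_induct_rule)
    case less
    show ?case
    proof (cases "\<exists>v. par v = Some (last xs)")
      case False
      with less.prems show ?thesis by (intro exI[of _ xs]) (auto simp: root_leaf_path_def)
    next
      case True
      then obtain v where v: "par v = Some (last xs)" by blast
      then have "v \<in> V" using assms(1) by (auto simp: rooted_forest_def dom_def)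
      with less.hyps[of "xs @ [v]"] less.prems v
      obtain ys where "root_leaf_path V par ys" "set (xs @ [v]) \<subseteq> set ys"
        by (auto simp: successively_append_iff)
      then show ?thesis by auto
    qed
  qed
qed

text \<open>By transitivity each vertex of the path is a proper ancestor of every later one, so a
  repetition would be a cycle. Distinctness makes the set of these paths finite and turns the weight
  of a list into a sum over a set.\<close>

lemma distinct_root_leaf_path:
  assumes "rooted_forest V par" "root_leaf_path V par xs"
  shows "distinct xs"
proof -
  have "successively (\<lambda>p v. (p, v) \<in> (parent_rel par)\<^sup>+) xs"
    by (rule successively_mono[where P = "\<lambda>p v. par v = Some p"])
       (use assms(2) in \<open>auto simp: root_leaf_path_def\<close>)
  moreover have "transp (\<lambda>p v. (p, v) \<in> (parent_rel par)\<^sup>+)"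
    by (auto intro: transpI)
  ultimately have "sorted_wrt (\<lambda>p v. (p, v) \<in> (parent_rel par)\<^sup>+) xs"
    by (simp add: successively_conv_sorted_wrt)
  moreover have "(p, p) \<notin> (parent_rel par)\<^sup>+" for p
    using assms(1) by (auto simp: rooted_forest_def acyclic_def)
  ultimately show ?thesis
    by (induction xs) auto
qed

lemma finite_root_leaf_paths:
  assumes "rooted_forest V par"
  shows "finite {xs. root_leaf_path V par xs}"
proof (rule finite_subset)
  show "{xs. root_leaf_path V par xs} \<subseteq> {xs. set xs \<subseteq> V \<and> distinct xs}"
    using distinct_root_leaf_path[OF assms] by (auto simp: root_leaf_path_def)
  show "finite {xs. set xs \<subseteq> V \<and> distinct xs}"
    using assms by (simp add: rooted_forest_def finite_subset_distinct)
qed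

lemma sum_ancestors_le_weighted_depth:
  assumes "rooted_forest V par" "v \<in> V"
  shows "sum w {u. (u, v) \<in> (parent_rel par)\<^sup>*} \<le> weighted_depth V w par"
proof -
  obtain xs where "xs \<noteq> []" "set xs \<subseteq> V" "{u. (u, v) \<in> (parent_rel par)\<^sup>*} \<subseteq> set xs"
    "par (hd xs) = None" "successively (\<lambda>p v. par v = Some p) xs"
    using root_path_exists[OF assms] by blast
  with extend_to_leaf[OF assms(1), of xs] obtain ys
    where ys: "root_leaf_path V par ys" "{u. (u, v) \<in> (parent_rel par)\<^sup>*} \<subseteq> set ys" by auto
  then have "sum w {u. (u, v) \<in> (parent_rel par)\<^sup>*} \<le> sum w (set ys)"
    by (intro sum_mono2) auto
  also have "\<dots> = sum_list (map w ys)"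
    using distinct_root_leaf_path[OF assms(1) ys(1)] by (simp add: sum_list_distinct_conv_sum_set)
  also have "\<dots> \<le> weighted_depth V w par"
    unfolding weighted_depth_def
  proof (rule Max_ge)
    have "{sum_list (map w xs) |xs. root_leaf_path V par xs} =
        (\<lambda>xs. sum_list (map w xs)) ` {xs. root_leaf_path V par xs}" by auto
    then show "finite {sum_list (map w xs) |xs. root_leaf_path V par xs}"
      using finite_root_leaf_paths[OF assms(1)] by simp
  qed (use ys in auto)
  finally show ?thesis .
qed

lemma weighted_depth_le:
  assumes "rooted_forest V par" "V \<noteq> {}"
    and "\<And>xs. root_leaf_path V par xs \<Longrightarrow> sum_list (map w xs) \<le> B"
  shows "weighted_depth V w par \<le> B"
proof -
  \<comment> \<open>\<open>Max\<close> of the empty set is unspecified, so some root-leaf path must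
    be exhibited; it can be grown from any vertex.\<close>
  obtain v where v: "v \<in> V" using assms(2) by auto
  obtain xs where "xs \<noteq> []" "set xs \<subseteq> V" "par (hd xs) = None"
    "successively (\<lambda>p v. par v = Some p) xs"
    using root_path_exists[OF assms(1) v] by blast
  with extend_to_leaf[OF assms(1), of xs] obtain ys where "root_leaf_path V par ys" by blast
  moreover have "{sum_list (map w xs) |xs. root_leaf_path V par xs} =
        (\<lambda>xs. sum_list (map w xs)) ` {xs. root_leaf_path V par xs}" by auto
  ultimately show ?thesis
    unfolding weighted_depth_def
    using finite_root_leaf_paths[OF assms(1)] assms(3) by (subst Max_le_iff) auto
qed


section \<open>The interval recurrence\<close>

function interval_depth :: "(nat \<Rightarrow> nat) \<Rightarrow> nat \<Rightarrow> nat \<Rightarrow> nat" where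
  "interval_depth x i j =
    (if i < j then Min ((\<lambda>k. x k + max (interval_depth x i k) (interval_depth x (Suc k) j)) ` {i..<j})
     else 0)"
  by auto
termination
  by (relation "measure (\<lambda>(x, i, j). j - i)") auto

text \<open>As a rewrite rule this unconditional recursive equation would unfold forever.\<close>

declare interval_depth.simps [simp del]

lemma interval_depth_empty [simp]: "j \<le> i \<Longrightarrow> interval_depth x i j = 0"
  by (subst interval_depth.simps) simp

lemma interval_depth_le:
  assumes "i \<le> k" "k < j"
  shows "interval_depth x i j \<le> x k + max (interval_depth x i k) (interval_depth x (Suc k) j)"
  using assms by (subst interval_depth.simps) (auto intro!: Min_le)

lemma interval_depth_eqI:
  assumes "i \<le> r" "r < j"
    and "d = x r + max (interval_depth x i r) (interval_depth x (Suc r) j)"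
    and "\<And>k. i \<le> k \<Longrightarrow> k < j \<Longrightarrow> d \<le> x k + max (interval_depth x i k) (interval_depth x (Suc k) j)"
  shows "interval_depth x i j = d"
  using assms by (subst interval_depth.simps) (auto intro!: Min_eqI)

text \<open>Read \<open>A k m\<close> as "the vertex at \<open>k\<close> is an ancestor of the one
  at \<open>m\<close> or equal to it". Going down from the topmost position of an interval always
  into the side with the larger optimum ends at an \<open>m\<close> whose ancestors weigh at least
  the optimum.\<close>

lemma interval_depth_le_chain:
  assumes top: "\<And>i j. i < j \<Longrightarrow> j \<le> n \<Longrightarrow> \<exists>k\<in>{i..<j}. \<forall>m\<in>{i..<j}. A k m"
  assumes "i < j" "j \<le> n"
  shows "\<exists>m\<in>{i..<j}. interval_depth x i j \<le> sum x {k\<in>{i..<j}. A k m}"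
  using assms(2,3)
proof (induction "j - i" arbitrary: i j rule: less_induct)
  case less
  obtain k where k: "k \<in> {i..<j}" "\<forall>m\<in>{i..<j}. A k m" using top less.prems by blast
  have le: "interval_depth x i j \<le> x k + max (interval_depth x i k) (interval_depth x (Suc k) j)"
    using k by (intro interval_depth_le) auto
  \<comment> \<open>This treats both sides at once: \<open>k\<close> lies outside
    \<open>{a..<b}\<close> and above all of it, so its weight comes on top of the sum from the
    induction hypothesis.\<close>
  have sub: "\<exists>m\<in>{i..<j}. interval_depth x i j \<le> sum x {k\<in>{i..<j}. A k m}"
    if "a < b" "i \<le> a" "b \<le> j" "k \<notin> {a..<b}" "interval_depth x i j \<le> x k + interval_depth x a b" for a b
  proof -
    have "b - a < j - i" using that k by (cases "a = i"; cases "b = j") auto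
    with less that obtain m where m: "m \<in> {a..<b}" "interval_depth x a b \<le> sum x {k\<in>{a..<b}. A k m}"
      by (meson order_trans)
    have "interval_depth x i j \<le> x k + sum x {k\<in>{a..<b}. A k m}" using that m by linarith
    also have "\<dots> = sum x (insert k {k\<in>{a..<b}. A k m})" using that by (subst sum.insert) auto
    also have "\<dots> \<le> sum x {k\<in>{i..<j}. A k m}" using that k m by (intro sum_mono2) auto
    finally show ?thesis using that m by (intro bexI[of _ m]) auto
  qed
  show ?case
  proof (cases "interval_depth x (Suc k) j \<le> interval_depth x i k")
    case True
    show ?thesis
    proof (cases "i < k")
      case True
      with sub[of i k] \<open>_ \<le> interval_depth x i k\<close> le k show ?thesis by auto
    next
      case False
      \<comment> \<open>The left side is empty and has optimum 0, and the right one is no larger, so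
        only \<open>x k\<close> remains and \<open>m = k\<close> works.\<close>
      then have "interval_depth x i j \<le> sum x {k}" using True le k by auto
      also have "\<dots> \<le> sum x {l\<in>{i..<j}. A l k}" using k by (intro sum_mono2) auto
      finally show ?thesis using k by blast
    qed
  next
    case False
    then have "Suc k < j" by (rule_tac ccontr) simp
    with sub[of "Suc k" j] False le k show ?thesis by auto
  qed
qed

text \<open>This is the lower bound for an arbitrary decomposition: every interval of positions has
  a topmost vertex, so the chain lemma yields a vertex whose ancestors alone weigh at least the
  optimum of the recurrence.\<close>

lemma interval_depth_le_weighted_depth:
  assumes td: "treedepth_decomposition V E par"
    and vs: "vs \<noteq> []" "distinct vs" "V = set vs"
    and E: "E = {{vs ! i, vs ! Suc i} |i. Suc i < length vs}"
  shows "interval_depth (\<lambda>p. w (vs ! p)) 0 (length vs) \<le> weighted_depth V w par"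
proof -
  let ?A = "\<lambda>k m. (vs ! k, vs ! m) \<in> (parent_rel par)\<^sup>*"
  have rf: "rooted_forest V par" using td by (simp add: treedepth_decomposition_def)
  have edge: "?A i (Suc i) \<or> ?A (Suc i) i" if "Suc i < length vs" for i
  proof -
    have "{vs ! i, vs ! Suc i} \<in> E" using that E by auto
    then have "ancestor par (vs ! i) (vs ! Suc i) \<or> ancestor par (vs ! Suc i) (vs ! i)"
      using td by (simp add: treedepth_decomposition_def)
    then show ?thesis unfolding ancestor_def by (auto dest: trancl_into_rtrancl)
  qed
  have top: "\<exists>k\<in>{i..<j}. \<forall>m\<in>{i..<j}. ?A k m" if "i < j" "j \<le> length vs" for i j
    using that
  proof (induction j)
    case (Suc j)
    show ?case
    proof (cases "i = j")
      case True
      then show ?thesis by (intro bexI[of _ j]) auto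
    next
      case False
      then obtain k where k: "k \<in> {i..<j}" "\<forall>m\<in>{i..<j}. ?A k m" using Suc by fastforce
      obtain l where l: "j = Suc l" "l \<in> {i..<j}" using False Suc.prems by (cases j) auto
      \<comment> \<open>The edge makes \<open>l\<close> and \<open>j\<close> comparable. If
        \<open>l\<close> is above \<open>j\<close>, then so is \<open>k\<close>; otherwise
        \<open>j\<close> and \<open>k\<close> are both above \<open>l\<close> and hence
        comparable.\<close>
      have "?A k j \<or> ?A j k"
        using edge[of l] l k Suc.prems parent_rel_comparable
        by (metis Suc_le_lessD rtrancl_trans)
      then show ?thesis
      proof
        assume "?A k j"
        with k show ?thesis by (intro bexI[of _ k]) (auto simp: less_Suc_eq)
      next
        assume "?A j k"
        with k Suc.prems show ?thesis
          by (intro bexI[of _ j]) (auto simp: less_Suc_eq intro: rtrancl_trans)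
      qed
    qed
  qed simp
  obtain m where m: "m < length vs"
    "interval_depth (\<lambda>p. w (vs ! p)) 0 (length vs) \<le>
       (\<Sum>k | k < length vs \<and> ?A k m. w (vs ! k))"
    using interval_depth_le_chain[of "length vs" ?A 0 "length vs" "\<lambda>p. w (vs ! p)"] top vs(1)
    by auto
  note m(2)
  also have "(\<Sum>k | k < length vs \<and> ?A k m. w (vs ! k)) =
      sum w ((!) vs ` {k. k < length vs \<and> ?A k m})"
    using vs(2) by (subst sum.reindex) (auto simp: inj_on_def nth_eq_iff_index_eq)
  also have "\<dots> \<le> sum w {u. (u, vs ! m) \<in> (parent_rel par)\<^sup>*}"
  proof (rule sum_mono2)
    have "{u. (u, vs ! m) \<in> (parent_rel par)\<^sup>*} \<subseteq> V"
      using root_path_exists[OF rf, of "vs ! m"] m(1) vs(3) by auto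
    then show "finite {u. (u, vs ! m) \<in> (parent_rel par)\<^sup>*}"
      using rf by (auto simp: rooted_forest_def intro: finite_subset)
  qed auto
  also have "\<dots> \<le> weighted_depth V w par"
    using m(1) vs(3) by (intro sum_ancestors_le_weighted_depth[OF rf]) auto
  finally show ?thesis .
qed

section \<open>From splitting positions to a decomposition\<close>

text \<open>The list of positions met when one searches for \<open>p\<close> by splitting each interval \<open>{a..<b}\<close> at \<open>r a b\<close>,
  ending with \<open>p\<close>; the test that \<open>r i j\<close> lies in the interval only ensures termination.\<close>

function descent :: "(nat \<Rightarrow> nat \<Rightarrow> nat) \<Rightarrow> nat \<Rightarrow> nat \<Rightarrow> nat \<Rightarrow> nat list" where
  "descent r i j p =
    (let k = r i j in
     if i \<le> k \<and> k < j \<and> k \<noteq> p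
     then k # (if p < k then descent r i k p else descent r (Suc k) j p)
     else [p])"
  by auto
termination
  by (relation "measure (\<lambda>(r, i, j, p). j - i)") auto

declare descent.simps [simp del]

definition splits :: "(nat \<Rightarrow> nat) \<Rightarrow> nat \<Rightarrow> (nat \<Rightarrow> nat \<Rightarrow> nat) \<Rightarrow> bool" where
  "splits x n r \<longleftrightarrow> (\<forall>i j. i < j \<longrightarrow> j \<le> n \<longrightarrow> i \<le> r i j \<and> r i j < j \<and>
     interval_depth x i j =
       x (r i j) + max (interval_depth x i (r i j)) (interval_depth x (Suc (r i j)) j))"

lemma splits_range:
  assumes "splits x n r" "i < j" "j \<le> n"
  shows "i \<le> r i j" "r i j < j"
  using assms by (auto simp: splits_def)

lemma descent_root: "r i j = p \<Longrightarrow> descent r i j p = [p]"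
  by (subst descent.simps) (simp add: Let_def)

lemma descent_left:
  assumes "splits x n r" "i \<le> p" "p < r i j" "i < j" "j \<le> n"
  shows "descent r i j p = r i j # descent r i (r i j) p"
  using assms splits_range[OF assms(1,4,5)] by (subst descent.simps) (simp add: Let_def)

lemma descent_right:
  assumes "splits x n r" "r i j < p" "p < j" "i < j" "j \<le> n"
  shows "descent r i j p = r i j # descent r (Suc (r i j)) j p"
  using assms splits_range[OF assms(1,4,5)] by (subst descent.simps) (simp add: Let_def)

lemma descent_not_Nil [simp]: "descent r i j p \<noteq> []"
  by (subst descent.simps) (simp add: Let_def)

lemma last_descent [simp]: "last (descent r i j p) = p"
  by (induction r i j p rule: descent.induct) (subst descent.simps, auto simp: Let_def)

text \<open>The induction follows the search for \<open>p\<close>. By \<open>splits\<close> every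
  recorded position lies in its interval, so the search stops only at \<open>p\<close>
  itself.\<close>

lemma descent_induct [consumes 4, case_names root left right]:
  assumes "splits x n r" "i \<le> p" "p < j" "j \<le> n"
    and "\<And>i j. i \<le> p \<Longrightarrow> p < j \<Longrightarrow> j \<le> n \<Longrightarrow> r i j = p \<Longrightarrow> P i j"
    and "\<And>i j. i \<le> p \<Longrightarrow> p < r i j \<Longrightarrow> r i j < j \<Longrightarrow> j \<le> n \<Longrightarrow> P i (r i j) \<Longrightarrow> P i j"
    and "\<And>i j. i \<le> r i j \<Longrightarrow> r i j < p \<Longrightarrow> p < j \<Longrightarrow> j \<le> n \<Longrightarrow> P (Suc (r i j)) j \<Longrightarrow> P i j"
  shows "P i j"
  using assms(2-4)
proof (induction "j - i" arbitrary: i j rule: less_induct)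
  case less
  then have k: "i \<le> r i j" "r i j < j" using splits_range[OF assms(1), of i j] by auto
  consider "r i j = p" | "p < r i j" | "r i j < p" by linarith
  then show ?case
  proof cases
    case 1
    with less.prems assms(5) show ?thesis by blast
  next
    case 2
    then have "P i (r i j)" using less.hyps[of "r i j" i] less.prems k by auto
    with 2 k less.prems show ?thesis using assms(6) by blast
  next
    case 3
    then have "P (Suc (r i j)) j" using less.hyps[of j "Suc (r i j)"] less.prems k by auto
    with 3 k less.prems show ?thesis using assms(7) by blast
  qed
qed

lemma set_descent:
  assumes "splits x n r" "i \<le> p" "p < j" "j \<le> n"
  shows "set (descent r i j p) \<subseteq> {i..<j}"
  using assms
proof (induction rule: descent_induct)
  case (left i j)
  then show ?case using descent_left[OF assms(1), of i p j] by auto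
next
  case (right i j)
  then show ?case using descent_right[OF assms(1), of i j p] by auto
qed (simp add: descent_root)

text \<open>As long as \<open>q\<close> has not been met, it lies in the same subinterval as
  \<open>p\<close>, so the search for \<open>q\<close> turns the same way. Thus the searches form a
  tree under taking prefixes.\<close>

lemma descent_prefix:
  assumes "splits x n r" "i \<le> p" "p < j" "j \<le> n" "descent r i j p = ys @ q # zs"
  shows "descent r i j q = ys @ [q]"
  using assms
proof (induction arbitrary: ys rule: descent_induct)
  case (root i j)
  then have "ys = [] \<and> q = p" by (cases ys) (simp_all add: descent_root)
  with root show ?case by (simp add: descent_root)
next
  case (left i j)
  then have *: "r i j # descent r i (r i j) p = ys @ q # zs"
    using descent_left[OF assms(1), of i p j] by simp
  show ?case
  proof (cases ys)
    case Nil
    with * show ?thesis by (simp add: descent_root)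
  next
    case (Cons y ys')
    with * left.IH[of ys'] have "y = r i j" and d: "descent r i (r i j) q = ys' @ [q]" by auto
    have "q \<in> set (descent r i (r i j) p)" using * Cons by auto
    with set_descent[OF assms(1), of i p "r i j"] left have "q \<in> {i..<r i j}" by auto
    with d left Cons \<open>y = r i j\<close> descent_left[OF assms(1), of i q j] show ?thesis by simp
  qed
next
  case (right i j)
  then have *: "r i j # descent r (Suc (r i j)) j p = ys @ q # zs"
    using descent_right[OF assms(1), of i j p] by simp
  show ?case
  proof (cases ys)
    case Nil
    with * show ?thesis by (simp add: descent_root)
  next
    case (Cons y ys')
    with * right.IH[of ys'] have "y = r i j" and d: "descent r (Suc (r i j)) j q = ys' @ [q]" by auto
    have "q \<in> set (descent r (Suc (r i j)) j p)" using * Cons by auto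
    with set_descent[OF assms(1), of "Suc (r i j)" p j] right have "q \<in> {Suc (r i j)..<j}" by auto
    with d right Cons \<open>y = r i j\<close> descent_right[OF assms(1), of i j q] show ?thesis by simp
  qed
qed

text \<open>Each step pays for the splitting position and moves to one side, whose optimum is at
  most the maximum in the recurrence.\<close>

lemma sum_descent_le:
  assumes "splits x n r" "i \<le> p" "p < j" "j \<le> n"
  shows "sum_list (map x (descent r i j p)) \<le> interval_depth x i j"
  using assms
proof (induction rule: descent_induct)
  case (root i j)
  with assms(1) show ?case by (auto simp: splits_def descent_root)
next
  case (left i j)
  with assms(1) have "interval_depth x i j =
       x (r i j) + max (interval_depth x i (r i j)) (interval_depth x (Suc (r i j)) j)"
    by (auto simp: splits_def)
  with left descent_left[OF assms(1), of i p j] show ?case by simp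
next
  case (right i j)
  with assms(1) have "interval_depth x i j =
       x (r i j) + max (interval_depth x i (r i j)) (interval_depth x (Suc (r i j)) j)"
    by (auto simp: splits_def)
  with right descent_right[OF assms(1), of i j p] show ?case by simp
qed

text \<open>No position lies between \<open>p\<close> and \<open>Suc p\<close>, so the two searches
  agree until one of the two positions is itself the splitting position; the search for the other
  then passes through it.\<close>

lemma descent_neighbours:
  assumes "splits x n r" "i \<le> p" "Suc p < j" "j \<le> n"
  shows "p \<in> set (descent r i j (Suc p)) \<or> Suc p \<in> set (descent r i j p)"
proof -
  have "p < j" using assms by simp
  from assms(1,2) this assms(4,3) show ?thesis
  proof (induction rule: descent_induct)
    case (root i j)
    then show ?case using descent_right[OF assms(1), of i j "Suc p"] by simp
  next
    case (left i j)
    then show ?case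
      using descent_left[OF assms(1), of i p j] descent_left[OF assms(1), of i "Suc p" j]
        descent_root[of r i j "Suc p"]
      by (cases "r i j = Suc p") auto
  next
    case (right i j)
    then show ?case
      using descent_right[OF assms(1), of i j p] descent_right[OF assms(1), of i j "Suc p"] by simp
  qed
qed

text \<open>A root gets itself as parent, which is how \<open>output_forest\<close> recognises
  roots.\<close>

definition descent_parent :: "(nat \<Rightarrow> nat \<Rightarrow> nat) \<Rightarrow> nat \<Rightarrow> nat \<Rightarrow> nat" where
  "descent_parent r n p = (let l = butlast (descent r 0 n p) in if l = [] then p else last l)"

text \<open>This recasts the prefix property as a recursion: the search for \<open>p\<close> is the
  search for its parent with \<open>p\<close> appended. All later arguments about ancestors and root
  paths use it in this form.\<close>

lemma descent_parent_cases:
  assumes "splits x n r" "p < n"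
  obtains "descent_parent r n p = p" "descent r 0 n p = [p]"
  | "descent_parent r n p \<noteq> p" "descent_parent r n p < n"
    "descent r 0 n p = descent r 0 n (descent_parent r n p) @ [p]"
proof (cases "butlast (descent r 0 n p) = []")
  case True
  then have "descent r 0 n p = [p]"
    by (metis append_Nil append_butlast_last_id descent_not_Nil last_descent)
  with True that(1) show ?thesis by (simp add: descent_parent_def)
next
  case False
  let ?l = "butlast (descent r 0 n p)"
  have q: "descent_parent r n p = last ?l" using False by (simp add: descent_parent_def Let_def)
  have l: "descent r 0 n p = butlast ?l @ last ?l # [p]"
    using append_butlast_last_id[OF False] append_butlast_last_id[of "descent r 0 n p"]
    by (metis append.assoc append_Cons append_Nil descent_not_Nil last_descent)
  then have d: "descent r 0 n (last ?l) = butlast ?l @ [last ?l]"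
    using descent_prefix[OF assms(1) _ assms(2) order_refl] by blast
  then have dp: "descent r 0 n p = descent r 0 n (last ?l) @ [p]" using l by simp
  have "last ?l \<in> set (descent r 0 n p)" by (subst l) simp
  then have "last ?l < n" using set_descent[OF assms(1) le0 assms(2) order_refl] by auto
  moreover have "last ?l \<noteq> p" using dp by (auto dest: arg_cong[of _ _ length])
  ultimately show ?thesis using dp that(2) unfolding q by blast
qed

lemma descent_parent_less:
  assumes "splits x n r" "p < n"
  shows "descent_parent r n p < n"
  using assms by (metis descent_parent_cases)

lemma optimal_decomposition_descent:
  assumes vs: "vs \<noteq> []" "distinct vs" "V = set vs" "length vs = n"
    and E: "E = {{vs ! i, vs ! Suc i} |i. Suc i < n}"
    and r: "splits (\<lambda>p. w (vs ! p)) n r"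
    and dom: "dom par \<subseteq> V"
    and par: "\<And>p. p < n \<Longrightarrow> par (vs ! p) =
      (if descent_parent r n p = p then None else Some (vs ! descent_parent r n p))"
  shows "optimal_decomposition V E w par"
proof -
  let ?d = "descent r 0 n"
  have pos: "\<exists>p<n. v = vs ! p" if "v \<in> V" for v
    using that vs by (auto simp: in_set_conv_nth)
  have step: "\<exists>p q. p < n \<and> q < n \<and> v = vs ! p \<and> u = vs ! q \<and> ?d p = ?d q @ [p]"
    if v: "par v = Some u" for u v
  proof -
    obtain p where p: "p < n" "v = vs ! p"
      using v dom pos by (meson domI subsetD)
    from r p(1) show ?thesis
    proof (cases rule: descent_parent_cases)
      case 1
      with v p par[OF p(1)] show ?thesis by simp
    next
      case 2
      with v p(2) par[OF p(1)] have "u = vs ! descent_parent r n p" by simp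
      with 2 p show ?thesis by blast
    qed
  qed
  have idx: "p = q" if "vs ! p = vs ! q" "p < n" "q < n" for p q
    using that vs by (simp add: nth_eq_iff_index_eq)
  \<comment> \<open>The length of the search grows from parent to child, so it is a rank that
    excludes cycles.\<close>
  define h where "h v = length (?d (THE p. p < n \<and> v = vs ! p))" for v
  have h: "h (vs ! p) = length (?d p)" if "p < n" for p
    unfolding h_def by (subst the_equality[of _ p]) (use that idx in auto)
  have "acyclic (parent_rel par)"
  proof (rule acyclic_subset[OF wf_acyclic[OF wf_measure[of h]]])
    have "h u < h v" if "par v = Some u" for u v
      using step[OF that] h by fastforce
    then show "parent_rel par \<subseteq> measure h" by auto
  qed
  moreover have "ran par \<subseteq> V"
  proof
    fix u assume "u \<in> ran par"
    then obtain v where "par v = Some u" by (auto simp: ran_def)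
    from step[OF this] vs show "u \<in> V" by auto
  qed
  ultimately have rf: "rooted_forest V par" using dom vs by (simp add: rooted_forest_def)
  have anc: "q = p \<or> ancestor par (vs ! q) (vs ! p)" if "p < n" "q \<in> set (?d p)" for p q
    using that
  proof (induction "length (?d p)" arbitrary: p rule: less_induct)
    case less
    from r less.prems(1) show ?case
    proof (cases rule: descent_parent_cases)
      case 1
      with less show ?thesis by simp
    next
      case 2
      let ?q = "descent_parent r n p"
      have *: "(vs ! ?q, vs ! p) \<in> parent_rel par" using 2 par less.prems by simp
      from 2 less.prems(2) consider "q = p" | "q \<in> set (?d ?q)" by (metis UnE append_is_Nil_conv
        empty_iff empty_set set_ConsD set_append)
      then show ?thesis
      proof cases
        case 2
        have "length (?d ?q) < length (?d p)"
          using \<open>?d p = ?d ?q @ [p]\<close> by (metis length_append_singleton lessI)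
        with less.hyps[of ?q] 2 \<open>?q < n\<close> have "q = ?q \<or> ancestor par (vs ! q) (vs ! ?q)" by blast
        with * show ?thesis unfolding ancestor_def by (metis r_into_trancl trancl_into_trancl)
      qed simp
    qed
  qed
  have "ancestor par u v \<or> ancestor par v u" if uv: "{u, v} \<in> E" for u v
  proof -
    obtain p where p: "Suc p < n" "{u, v} = {vs ! p, vs ! Suc p}" using uv E by blast
    have "ancestor par (vs ! p) (vs ! Suc p) \<or> ancestor par (vs ! Suc p) (vs ! p)"
      using descent_neighbours[OF r _ p(1) order_refl] anc[of p "Suc p"] anc[of "Suc p" p] p(1) by auto
    with p(2) show ?thesis by (auto simp: doubleton_eq_iff)
  qed
  with rf have td: "treedepth_decomposition V E par" by (simp add: treedepth_decomposition_def)
  \<comment> \<open>A path that starts at a root is the whole search for its last vertex, so its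
    weight is bounded by \<open>sum_descent_le\<close>.\<close>
  have path: "\<exists>p<n. last xs = vs ! p \<and> xs = map ((!) vs) (?d p)"
    if "xs \<noteq> []" "set xs \<subseteq> V" "par (hd xs) = None" "successively (\<lambda>p v. par v = Some p) xs" for xs
    using that
  proof (induction xs rule: rev_induct)
    case (snoc v xs)
    show ?case
    proof (cases "xs = []")
      case True
      obtain p where p: "p < n" "v = vs ! p" using pos snoc.prems by auto
      from r p(1) show ?thesis
      proof (cases rule: descent_parent_cases)
        case 2
        with par[OF p(1)] p(2) True snoc.prems show ?thesis by simp
      qed (use True p in auto)
    next
      case False
      with snoc.prems have "par v = Some (last xs)" "par (hd xs) = None" "set xs \<subseteq> V"
        "successively (\<lambda>p v. par v = Some p) xs" by (auto simp: successively_append_iff)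
      with snoc.IH False step[of v] idx show ?thesis by fastforce
    qed
  qed simp
  have "weighted_depth V w par \<le> interval_depth (\<lambda>p. w (vs ! p)) 0 n"
  proof (rule weighted_depth_le[OF rf])
    fix xs assume "root_leaf_path V par xs"
    then obtain p where p: "p < n" "xs = map ((!) vs) (?d p)"
      using path[of xs] by (auto simp: root_leaf_path_def)
    then show "sum_list (map w xs) \<le> interval_depth (\<lambda>p. w (vs ! p)) 0 n"
      using sum_descent_le[OF r _ p(1) order_refl] by (simp add: comp_def)
  qed (use vs in auto)
  moreover have "interval_depth (\<lambda>p. w (vs ! p)) 0 n \<le> weighted_depth V w par'"
    if "treedepth_decomposition V E par'" for par'
    using interval_depth_le_weighted_depth[OF that vs(1-3), of w] E vs(4) by simp
  ultimately show ?thesis using td by (meson optimal_decomposition_def order_trans)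
qed


section \<open>Timed total correctness\<close>

text \<open>An upper bound for the running time when every loop makes at most \<open>N\<close> iterations each time it is
  entered.\<close>

fun time_bound :: "nat \<Rightarrow> com \<Rightarrow> nat" where
  "time_bound N Skip = 1"
| "time_bound N (Assign x a) = 1 + acost a"
| "time_bound N (Write A i a) = 1 + acost i + acost a"
| "time_bound N (Seq c d) = time_bound N c + time_bound N d"
| "time_bound N (Cond b c d) = 1 + bcost b + time_bound N c + time_bound N d"
| "time_bound N (While b c) = 1 + bcost b + N * (1 + bcost b + time_bound N c)"

text \<open>The postcondition may again be a \<open>terminates\<close> statement, as in a weakest
  precondition calculus; this is how sequences are handled. The time budget depends on the program
  text and \<open>N\<close> only.\<close>

definition terminates :: "nat \<Rightarrow> com \<Rightarrow> state \<Rightarrow> (state \<Rightarrow> bool) \<Rightarrow> bool" where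
  "terminates N c s Q \<longleftrightarrow> (\<exists>t s'. exec c s t s' \<and> t \<le> time_bound N c \<and> Q s')"

lemma terminates_mono:
  assumes "terminates N c s P" "\<And>s'. P s' \<Longrightarrow> Q s'"
  shows "terminates N c s Q"
  using assms unfolding terminates_def by blast

lemma terminates_Seq:
  assumes "terminates N c s (\<lambda>s'. terminates N d s' Q)"
  shows "terminates N (Seq c d) s Q"
  using assms unfolding terminates_def by (fastforce intro: exec.Seq add_mono)

text \<open>The variant \<open>m\<close> bounds the number of iterations left. The induction counts
  with \<open>m s\<close>, which is replaced by \<open>N\<close> only at the end.\<close>

lemma terminates_While:
  fixes m :: "state \<Rightarrow> nat"
  assumes "I s" "m s \<le> N"
    and body: "\<And>s. I s \<Longrightarrow> bval b s \<Longrightarrow> terminates N c s (\<lambda>s'. I s' \<and> m s' < m s)"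
    and post: "\<And>s. I s \<Longrightarrow> \<not> bval b s \<Longrightarrow> Q s"
  shows "terminates N (While b c) s Q"
proof -
  have "\<exists>t s'. exec (While b c) s t s' \<and> t \<le> 1 + bcost b + m s * (1 + bcost b + time_bound N c) \<and> Q s'"
    using assms(1)
  proof (induction "m s" arbitrary: s rule: less_induct)
    case less
    show ?case
    proof (cases "bval b s")
      case False
      with less.prems post exec.WhileFalse[OF False, of c] show ?thesis by fastforce
    next
      case True
      then obtain t s1 where 1: "exec c s t s1" "t \<le> time_bound N c" "I s1" "m s1 < m s"
        using body less.prems unfolding terminates_def by blast
      then obtain u s2 where 2: "exec (While b c) s1 u s2"
        "u \<le> 1 + bcost b + m s1 * (1 + bcost b + time_bound N c)" "Q s2"
        using less.hyps by blast
      have "1 + bcost b + t + u \<le> 1 + bcost b + Suc (m s1) * (1 + bcost b + time_bound N c)"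
        using 1 2 by simp
      also have "\<dots> \<le> 1 + bcost b + m s * (1 + bcost b + time_bound N c)"
        using 1(4) by (intro add_left_mono mult_right_mono) auto
      finally show ?thesis using exec.WhileTrue[OF True 1(1) 2(1)] 2(3) by blast
    qed
  qed
  moreover have "m s * (1 + bcost b + time_bound N c) \<le> N * (1 + bcost b + time_bound N c)"
    using assms(2) by (intro mult_right_mono) auto
  ultimately show ?thesis unfolding terminates_def by (fastforce intro: order_trans)
qed

section \<open>Symbolic execution of loop-free programs, and frame conditions\<close>

fun loop_free :: "com \<Rightarrow> bool" where
  "loop_free (Seq c d) \<longleftrightarrow> loop_free c \<and> loop_free d"
| "loop_free (Cond b c d) \<longleftrightarrow> loop_free c \<and> loop_free d"
| "loop_free (While b c) \<longleftrightarrow> False"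
| "loop_free c \<longleftrightarrow> True"

text \<open>A functional semantics, so that simplification can execute straight-line code. The value
  for \<open>While\<close> is a dummy, excluded by \<open>loop_free\<close>.\<close>

fun run :: "com \<Rightarrow> state \<Rightarrow> state" where
  "run Skip s = s"
| "run (Assign x a) s = s\<lparr>reg := (reg s)(x := aval a s)\<rparr>"
| "run (Write A i a) s = s\<lparr>arr := (arr s)(A := (arr s A)(aval i s := aval a s))\<rparr>"
| "run (Seq c d) s = run d (run c s)"
| "run (Cond b c d) s = (if bval b s then run c s else run d s)"
| "run (While b c) s = s"

lemma exec_run:
  assumes "loop_free c"
  shows "\<exists>t. exec c s t (run c s) \<and> t \<le> time_bound N c"
  using assms
proof (induction c arbitrary: s)
  case (Seq c d)
  then show ?case by (auto intro: exec.Seq add_mono) (meson exec.Seq add_mono)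
next
  case (Cond b c d)
  then show ?case
    by (cases "bval b s") (auto dest!: meta_spec[of _ s] intro: exec.CondTrue exec.CondFalse trans_le_add1)
qed (auto intro: exec.intros)

lemma terminates_run:
  assumes "loop_free c" "Q (run c s)"
  shows "terminates N c s Q"
  using exec_run[OF assms(1)] assms(2) unfolding terminates_def by blast

fun assigned :: "com \<Rightarrow> name set" where
  "assigned Skip = {}"
| "assigned (Assign x a) = {x}"
| "assigned (Write A i a) = {}"
| "assigned (Seq c d) = assigned c \<union> assigned d"
| "assigned (Cond b c d) = assigned c \<union> assigned d"
| "assigned (While b c) = assigned c"

fun written :: "com \<Rightarrow> name set" where
  "written Skip = {}"
| "written (Assign x a) = {}"
| "written (Write A i a) = {A}"
| "written (Seq c d) = written c \<union> written d"
| "written (Cond b c d) = written c \<union> written d"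
| "written (While b c) = written c"

lemma exec_frame:
  assumes "exec c s t s'"
  shows "(\<forall>x. x \<notin> assigned c \<longrightarrow> reg s' x = reg s x) \<and> (\<forall>A. A \<notin> written c \<longrightarrow> arr s' A = arr s A)"
  using assms by induction auto

text \<open>Specifications of loops can thus be silent about registers and arrays that the loop does
  not touch.\<close>

lemma terminates_frame:
  assumes "terminates N c s P"
    and "\<And>s'. P s' \<Longrightarrow> (\<And>x. x \<notin> assigned c \<Longrightarrow> reg s' x = reg s x) \<Longrightarrow>
      (\<And>A. A \<notin> written c \<Longrightarrow> arr s' A = arr s A) \<Longrightarrow> Q s'"
  shows "terminates N c s Q"
  using assms unfolding terminates_def by (metis exec_frame)


section \<open>The program\<close>

abbreviation increment :: "name \<Rightarrow> com" where
  "increment x \<equiv> Assign x (Add (Var x) (Const 1))"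

definition neighbours_body :: com where
  "neighbours_body =
     Seq (Assign ''u'' (Read ''tail'' (Var ''e'')))
    (Seq (Assign ''v'' (Read ''head'' (Var ''e'')))
    (Seq (Write ''sum'' (Var ''u'') (Add (Read ''sum'' (Var ''u'')) (Var ''v'')))
    (Seq (Write ''sum'' (Var ''v'') (Add (Read ''sum'' (Var ''v'')) (Var ''u'')))
    (Seq (Write ''degree'' (Var ''u'') (Add (Read ''degree'' (Var ''u'')) (Const 1)))
    (Seq (Write ''degree'' (Var ''v'') (Add (Read ''degree'' (Var ''v'')) (Const 1)))
         (increment ''e''))))))"

definition neighbours :: com where
  "neighbours = While (Less (Var ''e'') (Var ''edges'')) neighbours_body"

text \<open>Besides looking for an end of the path, the loop tabulates the multiples of
  \<open>n + 1\<close> in \<open>row\<close> by repeated addition, because the machine cannot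
  multiply.\<close>

definition endpoint_body :: com where
  "endpoint_body =
     Seq (Cond (Less (Read ''degree'' (Var ''i'')) (Const 2)) (Assign ''cur'' (Var ''i'')) Skip)
    (Seq (Write ''row'' (Add (Var ''i'') (Const 1))
           (Add (Read ''row'' (Var ''i'')) (Add (Var ''vertices'') (Const 1))))
         (increment ''i''))"

definition endpoint :: com where
  "endpoint = While (Less (Var ''i'') (Var ''vertices'')) endpoint_body"

text \<open>On a path, the successor of a vertex is the sum of its neighbours minus its predecessor.\<close>

definition walk_body :: com where
  "walk_body =
     Seq (Write ''order'' (Var ''p'') (Var ''cur''))
    (Seq (Assign ''q'' (Sub (Read ''sum'' (Var ''cur'')) (Var ''prev'')))
    (Seq (Assign ''prev'' (Var ''cur''))
    (Seq (Assign ''cur'' (Var ''q''))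
         (increment ''p''))))"

definition walk :: com where
  "walk = While (Less (Var ''p'') (Var ''vertices'')) walk_body"

abbreviation cell :: "aexp \<Rightarrow> aexp \<Rightarrow> aexp" where
  "cell a b \<equiv> Add (Read ''row'' a) b"

definition min_body :: com where
  "min_body =
     Seq (Assign ''a'' (Read ''depth'' (cell (Var ''i'') (Var ''k''))))
    (Seq (Assign ''b'' (Read ''depth'' (cell (Add (Var ''k'') (Const 1)) (Var ''j''))))
    (Seq (Cond (Less (Var ''a'') (Var ''b'')) (Assign ''a'' (Var ''b'')) Skip)
    (Seq (Assign ''a'' (Add (Read ''weight'' (Read ''order'' (Var ''k''))) (Var ''a'')))
    (Seq (Cond (Less (Var ''a'') (Var ''best''))
           (Seq (Assign ''best'' (Var ''a'')) (Assign ''root'' (Var ''k''))) Skip)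
         (increment ''k'')))))"

text \<open>The minimum starts from the candidate \<open>k = i\<close>, whose left side is empty, so
  no infinite initial value is needed.\<close>

definition interval_body :: com where
  "interval_body =
     Seq
      (Seq (Assign ''j'' (Add (Var ''i'') (Var ''len'')))
      (Seq (Assign ''best'' (Add (Read ''weight'' (Read ''order'' (Var ''i'')))
             (Read ''depth'' (cell (Add (Var ''i'') (Const 1)) (Var ''j'')))))
      (Seq (Assign ''root'' (Var ''i''))
           (Assign ''k'' (Add (Var ''i'') (Const 1))))))
    (Seq (While (Less (Var ''k'') (Var ''j'')) min_body)
      (Seq (Write ''depth'' (cell (Var ''i'') (Var ''j'')) (Var ''best''))
      (Seq (Write ''split'' (cell (Var ''i'') (Var ''j'')) (Var ''root''))
           (increment ''i''))))"

definition length_body :: com where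
  "length_body =
     Seq (Seq (increment ''len'') (Assign ''i'' (Const 0)))
         (While (Less (Add (Var ''i'') (Var ''len'')) (Add (Var ''vertices'') (Const 1))) interval_body)"

definition table :: com where
  "table = While (Less (Var ''len'') (Var ''vertices'')) length_body"

definition descend_body :: com where
  "descend_body =
     Seq (Assign ''q'' (Read ''split'' (cell (Var ''i'') (Var ''j''))))
         (Cond (Less (Var ''p'') (Var ''q''))
           (Assign ''j'' (Var ''q'')) (Assign ''i'' (Add (Var ''q'') (Const 1))))"

text \<open>Starting with \<open>q = p\<close> makes a root its own parent when the inner loop is
  never entered.\<close>

definition parent_body :: com where
  "parent_body =
     Seq (Seq (Assign ''i'' (Const 0)) (Seq (Assign ''j'' (Var ''vertices'')) (Assign ''q'' (Var ''p''))))
    (Seq (While (Neg (Equal (Read ''split'' (cell (Var ''i'') (Var ''j''))) (Var ''p''))) descend_body)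
    (Seq (Write ''parent'' (Read ''order'' (Var ''p'')) (Read ''order'' (Var ''q'')))
         (increment ''p'')))"

definition parents :: com where
  "parents = Seq (Assign ''p'' (Const 0)) (While (Less (Var ''p'') (Var ''vertices'')) parent_body)"

definition path_treedepth :: com where
  "path_treedepth = Seq neighbours (Seq endpoint (Seq walk (Seq table parents)))"

text \<open>Loops nest at most three deep, over \<open>len\<close>, \<open>i\<close> and
  \<open>k\<close>, so unfolding gives an explicit cubic polynomial.\<close>

lemma time_bound_path_treedepth: "(\<lambda>n. real (time_bound n path_treedepth)) \<in> O(\<lambda>n. real n ^ 3)"
  unfolding path_treedepth_def neighbours_def neighbours_body_def endpoint_def endpoint_body_def
    walk_def walk_body_def table_def length_body_def interval_body_def min_body_def parents_def
    parent_body_def descend_body_def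
  by simp real_asymp


section \<open>Traversing the path\<close>

definition traverses :: "'a list \<Rightarrow> 'a set set \<Rightarrow> bool" where
  "traverses vs E \<longleftrightarrow> vs \<noteq> [] \<and> distinct vs \<and> E = {{vs ! i, vs ! Suc i} |i. Suc i < length vs}"

lemma traverses_rev:
  assumes "traverses vs E"
  shows "traverses (rev vs) E"
proof -
  have *: "\<exists>j. Suc j < length vs \<and> {rev ws ! i, rev ws ! Suc i} = {ws ! j, ws ! Suc j}"
    if "Suc i < length vs" "length ws = length vs" for i and ws :: "'a list"
    \<comment> \<open>Edge \<open>i\<close> of the reversed list is edge
      \<open>length vs - 2 - i\<close> of the list.\<close>
    using that by (intro exI[of _ "length vs - Suc (Suc i)"]) (auto simp: rev_nth Suc_diff_Suc)
  have "{{vs ! i, vs ! Suc i} |i. Suc i < length vs} =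
      {{rev vs ! i, rev vs ! Suc i} |i. Suc i < length vs}"
    (is "?L = ?R")
  proof
    show "?L \<subseteq> ?R" using *[of _ "rev vs"] by auto
    show "?R \<subseteq> ?L" using *[of _ vs] by auto
  qed
  with assms show ?thesis by (simp add: traverses_def)
qed

text \<open>With the identity for \<open>f\<close> this is the sum of the neighbours of
  \<open>v\<close>, and with the constant 1 it is the degree.\<close>

definition incident :: "(nat \<Rightarrow> nat) \<Rightarrow> (nat \<times> nat) list \<Rightarrow> nat \<Rightarrow> nat" where
  "incident f es v =
     (\<Sum>e\<leftarrow>es. (if fst e = v then f (snd e) else 0) + (if snd e = v then f (fst e) else 0))"

text \<open>For symmetric \<open>g\<close> neither the order nor the orientation of the listed edges
  matters, so sums over the input may be taken along the path.\<close>

lemma sum_edge_list: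
  fixes g :: "nat \<Rightarrow> nat \<Rightarrow> nat"
  assumes "edge_list es E" "traverses vs E" and sym: "\<And>a b. g a b = g b a"
  shows "(\<Sum>e<length es. g (fst (es ! e)) (snd (es ! e))) = (\<Sum>i<length vs - 1. g (vs ! i) (vs ! Suc i))"
proof -
  \<comment> \<open>Symmetry makes \<open>g\<close> a function of the unordered edge, whose two ends
    are recovered as \<open>Min\<close> and \<open>Max\<close>.\<close>
  define h where "h X = g (Min X) (Max X)" for X
  have h: "h {a, b} = g a b" for a b
    using sym[of a b] by (auto simp: h_def min_def max_def)
  let ?d = "\<lambda>(u, v). {u, v}" and ?e = "\<lambda>i. {vs ! i, vs ! Suc i}"
  have E: "E = ?e ` {..<length vs - 1}" and d: "distinct vs"
    using assms(2) by (auto simp: traverses_def)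
  have inj: "inj_on ?e {..<length vs - 1}"
    by (rule inj_onI) (use d in \<open>auto simp: doubleton_eq_iff nth_eq_iff_index_eq\<close>)
  have "(\<Sum>e<length es. g (fst (es ! e)) (snd (es ! e))) = sum_list (map (\<lambda>e. g (fst e) (snd e)) es)"
    by (simp add: sum_list_sum_nth atLeast0LessThan)
  also have "map (\<lambda>e. g (fst e) (snd e)) es = map h (map ?d es)"
    by (simp add: h split_beta)
  also have "sum_list \<dots> = sum h E"
    using assms(1) by (simp add: edge_list_def sum_list_distinct_conv_sum_set del: map_map)
  also have "\<dots> = (\<Sum>i<length vs - 1. g (vs ! i) (vs ! Suc i))"
    unfolding E by (subst sum.reindex[OF inj]) (simp add: h)
  finally show ?thesis .
qed

lemma length_edge_list:
  assumes "edge_list es E" "traverses vs E"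
  shows "length es = length vs - 1"
  using sum_edge_list[OF assms, of "\<lambda>_ _. 1"] by simp

lemma incident_traverses:
  assumes "edge_list es E" "traverses vs E" and p: "p < length vs"
  shows "incident f es (vs ! p) =
    (if Suc p < length vs then f (vs ! Suc p) else 0) + (if 0 < p then f (vs ! (p - 1)) else 0)"
proof -
  have d: "distinct vs" using assms(2) by (simp add: traverses_def)
  have "incident f es (vs ! p) = (\<Sum>i<length vs - 1.
     (if vs ! i = vs ! p then f (vs ! Suc i) else 0) + (if vs ! Suc i = vs ! p then f (vs ! i) else 0))"
    using sum_edge_list[OF assms(1,2),
      of "\<lambda>a b. (if a = vs ! p then f b else 0) + (if b = vs ! p then f a else 0)"]
    by (simp add: incident_def sum_list_sum_nth atLeast0LessThan add.commute)
  also have "\<dots> = (\<Sum>i<length vs - 1.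
     (if i = p then f (vs ! Suc i) else 0) + (if Suc i = p then f (vs ! i) else 0))"
    using d p by (intro sum.cong) (auto simp: nth_eq_iff_index_eq)
  \<comment> \<open>The condition \<open>Suc i = p\<close> is solved for \<open>i\<close>, so that
    each sum has at most one nonzero term.\<close>
  also have "\<dots> = (\<Sum>i<length vs - 1. if i = p then f (vs ! Suc i) else 0) +
      (\<Sum>i<length vs - 1. if i = p - 1 \<and> 0 < p then f (vs ! i) else 0)"
    by (subst sum.distrib, intro arg_cong2[of _ _ _ _ "(+)"] sum.cong) auto
  also have "\<dots> = (if Suc p < length vs then f (vs ! Suc p) else 0) + (if 0 < p then f (vs ! (p - 1)) else 0)"
    using p by (cases "0 < p") (auto simp: sum.delta)
  finally show ?thesis .
qed

text \<open>A vertex with fewer than two neighbours is an end of the path; if it is the last vertex,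
  the list is reversed.\<close>

lemma obtain_traversal_from:
  assumes "edge_list es E" "traverses us E" "v \<in> set us" "incident (\<lambda>_. 1) es v < 2"
  obtains vs where "traverses vs E" "set vs = set us" "length vs = length us" "vs ! 0 = v"
proof -
  obtain p where p: "p < length us" "v = us ! p" using assms(3) by (auto simp: in_set_conv_nth)
  with assms incident_traverses[OF assms(1,2) p(1), of "\<lambda>_. 1"] have "p = 0 \<or> Suc p = length us"
    by (auto split: if_splits)
  then show thesis
  proof
    assume "p = 0"
    with p assms(2) that[of us] show thesis by simp
  next
    assume "Suc p = length us"
    then have "rev us ! 0 = us ! p" using p(1) by (auto simp: rev_nth dest: sym)
    with p(2) that[of "rev us"] traverses_rev[OF assms(2)] show thesis by simp
  qed
qed

text \<open>The two nested updates mirror the two successive array writes of the loop body.\<close>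

lemma incident_take_Suc:
  assumes "e < length es"
  shows "incident f (take (Suc e) es) =
    (let g = incident f (take e es);
         h = g(fst (es ! e) := g (fst (es ! e)) + f (snd (es ! e)))
     in h(snd (es ! e) := h (snd (es ! e)) + f (fst (es ! e))))"
proof -
  have "incident f (take (Suc e) es) v = incident f (take e es) v +
      ((if fst (es ! e) = v then f (snd (es ! e)) else 0) +
       (if snd (es ! e) = v then f (fst (es ! e)) else 0))" for v
    using assms by (simp add: incident_def take_Suc_conv_app_nth)
  then show ?thesis by (simp add: fun_eq_iff Let_def)
qed

section \<open>Timed correctness of recovering the order of the vertices\<close>

lemma terminates_neighbours:
  assumes "reg s ''e'' = 0" "reg s ''edges'' = length es" "length es \<le> N"
    "arr s ''sum'' = (\<lambda>_. 0)" "arr s ''degree'' = (\<lambda>_. 0)"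
    "\<And>e. e < length es \<Longrightarrow> arr s ''tail'' e = fst (es ! e)"
    "\<And>e. e < length es \<Longrightarrow> arr s ''head'' e = snd (es ! e)"
  shows "terminates N neighbours s (\<lambda>s'.
    arr s' ''sum'' = incident (\<lambda>u. u) es \<and> arr s' ''degree'' = incident (\<lambda>_. 1) es)"
  unfolding neighbours_def
proof (rule terminates_While[where m = "\<lambda>s. length es - reg s ''e''" and I = "\<lambda>s.
    reg s ''e'' \<le> length es \<and> reg s ''edges'' = length es \<and>
    (\<forall>e<length es. arr s ''tail'' e = fst (es ! e) \<and> arr s ''head'' e = snd (es ! e)) \<and>
    arr s ''sum'' = incident (\<lambda>u. u) (take (reg s ''e'') es) \<and>
    arr s ''degree'' = incident (\<lambda>_. 1) (take (reg s ''e'') es)"], goal_cases)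
  case (3 s)
  then show ?case
    unfolding neighbours_body_def
    by (intro terminates_run) (simp_all add: incident_take_Suc Let_def)
qed (use assms in \<open>simp_all add: incident_def fun_eq_iff\<close>)

lemma terminates_endpoint:
  assumes "reg s ''i'' = 0" "reg s ''vertices'' = n" "arr s ''row'' = (\<lambda>_. 0)"
    "v < n" "arr s ''degree'' v < 2"
  shows "terminates n endpoint s (\<lambda>s'. reg s' ''cur'' < n \<and> arr s ''degree'' (reg s' ''cur'') < 2 \<and>
    (\<forall>i\<le>n. arr s' ''row'' i = i * (n + 1)))"
  unfolding endpoint_def
proof (rule terminates_While[where m = "\<lambda>s. n - reg s ''i''" and I = "\<lambda>s'.
    reg s' ''i'' \<le> n \<and> reg s' ''vertices'' = n \<and> arr s' ''degree'' = arr s ''degree'' \<and>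
    (\<forall>i\<le>reg s' ''i''. arr s' ''row'' i = i * (n + 1)) \<and>
    ((\<exists>v<reg s' ''i''. arr s ''degree'' v < 2) \<longrightarrow>
      reg s' ''cur'' < n \<and> arr s ''degree'' (reg s' ''cur'') < 2)"], goal_cases)
  case (3 s)
  then show ?case
    unfolding endpoint_body_def
    by (intro terminates_run) (auto simp: less_Suc_eq le_Suc_eq)
next
  case (4 s)
  then show ?case using assms by auto
qed (use assms in auto)

lemma terminates_walk:
  assumes "edge_list es E" "traverses vs E" "length vs = n"
    and "reg s ''p'' = 0" "reg s ''prev'' = 0" "reg s ''vertices'' = n" "reg s ''cur'' = vs ! 0"
    "arr s ''sum'' = incident (\<lambda>u. u) es"
  shows "terminates n walk s (\<lambda>s'. \<forall>p<n. arr s' ''order'' p = vs ! p)"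
  unfolding walk_def
\<comment> \<open>At the first vertex \<open>prev\<close> is 0 and the neighbour sum is already the
  successor. After the last vertex \<open>cur\<close> is meaningless, hence its guard
  \<open>p < n\<close>.\<close>
proof (rule terminates_While[where m = "\<lambda>s. n - reg s ''p''" and I = "\<lambda>s.
    reg s ''p'' \<le> n \<and> reg s ''vertices'' = n \<and> arr s ''sum'' = incident (\<lambda>u. u) es \<and>
    (reg s ''p'' < n \<longrightarrow> reg s ''cur'' = vs ! reg s ''p'') \<and>
    reg s ''prev'' = (if 0 < reg s ''p'' then vs ! (reg s ''p'' - 1) else 0) \<and>
    (\<forall>p<reg s ''p''. arr s ''order'' p = vs ! p)"], goal_cases)
  case (3 s)
  then show ?case
    unfolding walk_body_def using incident_traverses[OF assms(1,2), of "reg s ''p''" "\<lambda>u. u"] assms(3)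
    by (intro terminates_run) (auto simp: less_Suc_eq)
qed (use assms in auto)

section \<open>Filling the table\<close>

text \<open>Row-major addressing with rows of length \<open>n + 1\<close>, since the right end of an
  interval ranges over \<open>0..n\<close>.\<close>

definition index :: "nat \<Rightarrow> nat \<Rightarrow> nat \<Rightarrow> nat" where
  "index n i j = i * (n + 1) + j"

lemma index_eq_iff:
  assumes "j \<le> n" "j' \<le> n"
  shows "index n i j = index n i' j' \<longleftrightarrow> i = i' \<and> j = j'"
proof -
  have "index n i j div (n + 1) = i" "index n i j mod (n + 1) = j" if "j \<le> n" for i j
    using that by (simp_all add: index_def div_mult_self1 mod_mult_self1 del: mult_Suc_right)
  with assms show ?thesis by metis
qed

text \<open>The invariant shared by the later phases. The table \<open>row\<close> is described
  through \<open>row i + j\<close>, the shape in which \<open>cell\<close> is evaluated.\<close>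

definition prepared :: "nat \<Rightarrow> (nat \<Rightarrow> nat) \<Rightarrow> state \<Rightarrow> bool" where
  "prepared n x s \<longleftrightarrow> reg s ''vertices'' = n \<and> (\<forall>i j. i \<le> n \<longrightarrow> arr s ''row'' i + j = index n i j) \<and>
     (\<forall>p<n. arr s ''weight'' (arr s ''order'' p) = x p)"

definition split_value :: "(nat \<Rightarrow> nat) \<Rightarrow> nat \<Rightarrow> nat \<Rightarrow> nat \<Rightarrow> nat" where
  "split_value x i j k = x k + max (interval_depth x i k) (interval_depth x (Suc k) j)"

lemma terminates_min:
  assumes "prepared n x s" "reg s ''i'' = i" "reg s ''j'' = j" "i < j" "j \<le> n"
    and "\<forall>k. i \<le> k \<and> k < j \<longrightarrow> arr s ''depth'' (index n i k) = interval_depth x i k"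
    and "\<forall>k. i \<le> k \<and> k < j \<longrightarrow> arr s ''depth'' (index n (Suc k) j) = interval_depth x (Suc k) j"
    and "reg s ''k'' = Suc i" "reg s ''root'' = i" "reg s ''best'' = split_value x i j i"
  shows "terminates n (While (Less (Var ''k'') (Var ''j'')) min_body) s (\<lambda>s'.
    i \<le> reg s' ''root'' \<and> reg s' ''root'' < j \<and> reg s' ''best'' = interval_depth x i j \<and>
    interval_depth x i j = split_value x i j (reg s' ''root''))"
proof (rule terminates_While[where m = "\<lambda>s. j - reg s ''k''" and I = "\<lambda>s'.
    prepared n x s' \<and> arr s' ''depth'' = arr s ''depth'' \<and> reg s' ''i'' = i \<and> reg s' ''j'' = j \<and>
    i \<le> reg s' ''root'' \<and> reg s' ''root'' < reg s' ''k'' \<and> reg s' ''k'' \<le> j \<and>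
    reg s' ''best'' = split_value x i j (reg s' ''root'') \<and>
    (\<forall>k. i \<le> k \<and> k < reg s' ''k'' \<longrightarrow> reg s' ''best'' \<le> split_value x i j k)"], goal_cases)
  case (3 s')
  define k where "k = reg s' ''k''"
  have k: "i \<le> k" "k < j" "k < n" "Suc k \<le> n" "i \<le> n" using 3 assms by (auto simp: k_def)
  have row: "arr s' ''row'' i + b = index n i b" "arr s' ''row'' (Suc k) + b = index n (Suc k) b" for b
    using 3 k by (auto simp: prepared_def)
  have depth: "arr s' ''depth'' (index n i k) = interval_depth x i k"
    "arr s' ''depth'' (index n (Suc k) j) = interval_depth x (Suc k) j"
    using 3 k assms(6,7) by auto
  have x: "arr s' ''weight'' (arr s' ''order'' k) = x k" using 3 k by (auto simp: prepared_def)
  have regs: "reg s' ''i'' = i" "reg s' ''j'' = j" "reg s' ''k'' = k" using 3 by (auto simp: k_def)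
  let ?s = "run min_body s'"
  have run: "arr ?s = arr s'" "reg ?s ''i'' = i" "reg ?s ''j'' = j" "reg ?s ''k'' = Suc k"
    "reg ?s ''vertices'' = reg s' ''vertices''"
    "reg ?s ''best'' = min (reg s' ''best'') (split_value x i j k)"
    "reg ?s ''root'' = (if split_value x i j k < reg s' ''best'' then k else reg s' ''root'')"
    by (simp_all add: min_body_def regs row depth x split_value_def min_def max_def)
  have "loop_free min_body" by (simp add: min_body_def)
  then show ?case
    by (rule terminates_run)
       (use 3 k run regs in \<open>auto simp: less_Suc_eq prepared_def min_def\<close>)
next
  case (4 s')
  \<comment> \<open>At the exit every candidate below \<open>j\<close> has been compared, and
    \<open>root\<close> attains the value in \<open>best\<close>.\<close>
  then have "interval_depth x i j = reg s' ''best''"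
    by (intro interval_depth_eqI[of _ "reg s' ''root''"]) (auto simp: split_value_def)
  with 4 show ?case by auto
qed (use assms in \<open>auto simp: less_Suc_eq\<close>)

definition filled :: "nat \<Rightarrow> (nat \<Rightarrow> nat) \<Rightarrow> state \<Rightarrow> nat \<Rightarrow> nat \<Rightarrow> bool" where
  "filled n x s i j \<longleftrightarrow> arr s ''depth'' (index n i j) = interval_depth x i j \<and>
     (i < j \<longrightarrow> i \<le> arr s ''split'' (index n i j) \<and> arr s ''split'' (index n i j) < j \<and>
       interval_depth x i j = split_value x i j (arr s ''split'' (index n i j)))"

text \<open>The last conjunct says that filling one cell spoils no other; it rests on
  \<open>index_eq_iff\<close>, whence the restriction \<open>b \<le> n\<close>.\<close>

lemma terminates_interval_body:
  assumes "prepared n x s" "reg s ''i'' = i" "reg s ''len'' = l" "0 < l" "i + l \<le> n"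
    and "\<And>a b. a \<le> b \<Longrightarrow> b \<le> n \<Longrightarrow> b - a < l \<Longrightarrow> filled n x s a b"
  shows "terminates n interval_body s (\<lambda>s'. reg s' ''i'' = Suc i \<and> filled n x s' i (i + l) \<and>
    (\<forall>a b. b \<le> n \<longrightarrow> (a, b) \<noteq> (i, i + l) \<longrightarrow> filled n x s a b \<longrightarrow> filled n x s' a b))"
proof -
  have row: "arr s ''row'' i + b = index n i b" "arr s ''row'' (Suc i) + b = index n (Suc i) b" for b
    using assms by (auto simp: prepared_def)
  have x: "arr s ''weight'' (arr s ''order'' i) = x i" using assms by (auto simp: prepared_def)
  have depth: "arr s ''depth'' (index n a b) = interval_depth x a b" if "a \<le> b" "b \<le> n" "b - a < l" for a b
    using assms(6)[OF that] by (simp add: filled_def)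
  have left: "\<forall>k. i \<le> k \<and> k < i + l \<longrightarrow> arr s ''depth'' (index n i k) = interval_depth x i k"
    and right: "\<forall>k. i \<le> k \<and> k < i + l \<longrightarrow>
      arr s ''depth'' (index n (Suc k) (i + l)) = interval_depth x (Suc k) (i + l)"
    using assms(4,5) by (auto intro!: depth)
  have first: "arr s ''depth'' (index n (Suc i) (i + l)) = interval_depth x (Suc i) (i + l)"
    using right assms(4) by simp
  show ?thesis unfolding interval_body_def
    apply (rule terminates_Seq, rule terminates_run, simp, rule terminates_Seq)
    apply (rule terminates_frame[OF terminates_min[of n x _ i "i + l"]])
              apply (use assms(1-5) row x left right first in \<open>simp_all add: prepared_def split_value_def\<close>)[10]
    subgoal for s'
      apply (rule terminates_run)
      using assms row
      by (auto simp: min_body_def filled_def index_eq_iff)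
    done
qed

text \<open>The outer invariant covers all intervals of length at most \<open>len\<close>. It holds
  initially because empty intervals have optimum 0, the initial content of
  \<open>depth\<close>.\<close>

lemma terminates_table:
  assumes "prepared n x s" "reg s ''len'' = 0" "arr s ''depth'' = (\<lambda>_. 0)"
  shows "terminates n table s (\<lambda>s'. splits x n (\<lambda>i j. arr s' ''split'' (index n i j)))"
  unfolding table_def
proof (rule terminates_While[where m = "\<lambda>s. n - reg s ''len''" and I = "\<lambda>s. prepared n x s \<and>
    reg s ''len'' \<le> n \<and> (\<forall>a b. a \<le> b \<and> b \<le> n \<and> b - a \<le> reg s ''len'' \<longrightarrow> filled n x s a b)"], goal_cases)
  case (3 s)
  define l where "l = Suc (reg s ''len'')"
  have loop: "terminates n (While (Less (Add (Var ''i'') (Var ''len'')) (Add (Var ''vertices'') (Const 1))) interval_body)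
    s0 (\<lambda>s'. \<forall>a b. a \<le> b \<and> b \<le> n \<and> b - a \<le> l \<longrightarrow> filled n x s' a b)"
    if s0: "prepared n x s0" "reg s0 ''i'' = 0" "reg s0 ''len'' = l"
      "\<forall>a b. a \<le> b \<and> b \<le> n \<and> b - a < l \<longrightarrow> filled n x s0 a b" for s0
  proof (rule terminates_While[where m = "\<lambda>s. n - reg s ''i''" and I = "\<lambda>s. prepared n x s \<and>
      reg s ''len'' = l \<and> (\<forall>a b. a \<le> b \<and> b \<le> n \<and> (b - a < l \<or> b - a = l \<and> a < reg s ''i'') \<longrightarrow>
         filled n x s a b)"], goal_cases)
    case (3 s)
    show ?case
    proof (rule terminates_frame[OF terminates_interval_body[of n x s "reg s ''i''" l]], goal_cases)
      case (7 s')
      from 7(2,3) have "prepared n x s'" "reg s' ''len'' = l"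
        using 3 by (auto simp: prepared_def interval_body_def min_body_def)
      moreover have "filled n x s' a b"
        if "a \<le> b" "b \<le> n" "b - a < l \<or> b - a = l \<and> a < Suc (reg s ''i'')" for a b
      proof (cases "(a, b) = (reg s ''i'', reg s ''i'' + l)")
        case True
        with 7 show ?thesis by simp
      next
        case False
        with that have "b - a < l \<or> b - a = l \<and> a < reg s ''i''" by auto
        with that 3 have "filled n x s a b" by blast
        with 7 False that show ?thesis by blast
      qed
      ultimately show ?case using 3 7 l_def by (auto simp: prepared_def)
    qed (use 3 l_def in \<open>auto simp: prepared_def\<close>)
  next
    case (4 s)
    show ?case
    proof (intro allI impI)
      fix a b assume "a \<le> b \<and> b \<le> n \<and> b - a \<le> l"
      \<comment> \<open>Any interval of length \<open>l\<close> that ends by \<open>n\<close>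
        therefore starts before \<open>i\<close> and has been filled.\<close>
      moreover have "n < reg s ''i'' + l" using 4 by (auto simp: prepared_def)
      ultimately have "a \<le> b \<and> b \<le> n \<and> (b - a < l \<or> b - a = l \<and> a < reg s ''i'')" by linarith
      with 4 show "filled n x s a b" by blast
    qed
  qed (use s0 in auto)
  show ?case unfolding length_body_def
    apply (rule terminates_Seq, rule terminates_run, simp)
    apply (rule terminates_frame[OF loop])
    using 3 by (auto simp: l_def prepared_def filled_def interval_body_def min_body_def less_Suc_eq_le)
next
  case (4 s)
  then show ?case by (auto simp: splits_def filled_def prepared_def split_value_def)
qed (use assms in \<open>auto simp: filled_def prepared_def\<close>)

section \<open>Timed correctness of the searches and of writing the parents\<close>

lemma terminates_descend:
  assumes "prepared n x s" "splits x n r" "r = (\<lambda>i j. arr s ''split'' (index n i j))"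
    and "reg s ''p'' = p" "reg s ''q'' = p" "p < n" "reg s ''i'' = 0" "reg s ''j'' = n"
  shows "terminates n (While (Neg (Equal (Read ''split'' (cell (Var ''i'') (Var ''j''))) (Var ''p''))) descend_body)
    s (\<lambda>s'. reg s' ''q'' = descent_parent r n p)"
\<comment> \<open>The list \<open>ys\<close> holds the positions already met and \<open>q\<close> is
  the latest of them; the rest of the search takes place in the current interval.\<close>
proof (rule terminates_While[where m = "\<lambda>s. reg s ''j'' - reg s ''i''" and I = "\<lambda>s'.
    prepared n x s' \<and> arr s' ''split'' = arr s ''split'' \<and> reg s' ''p'' = p \<and>
    reg s' ''i'' \<le> p \<and> p < reg s' ''j'' \<and> reg s' ''j'' \<le> n \<and>
    (\<exists>ys. descent r 0 n p = ys @ descent r (reg s' ''i'') (reg s' ''j'') p \<and>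
       reg s' ''q'' = (if ys = [] then p else last ys))"], goal_cases)
  case (3 s')
  define i j where "i = reg s' ''i''" and "j = reg s' ''j''"
  obtain ys where ys: "descent r 0 n p = ys @ descent r i j p" using 3 by (auto simp: i_def j_def)
  have split: "arr s' ''split'' (arr s' ''row'' i + j) = r i j"
    using 3 assms(3) by (auto simp: prepared_def i_def)
  have ij: "i \<le> p" "p < j" "j \<le> n" using 3 by (auto simp: i_def j_def)
  then have r: "i \<le> r i j" "r i j < j" using splits_range[OF assms(2), of i j] by auto
  have p: "reg s' ''p'' = p" using 3 by simp
  let ?s = "run descend_body s'"
  have run: "arr ?s = arr s'" "reg ?s ''vertices'' = reg s' ''vertices''" "reg ?s ''p'' = p"
    "reg ?s ''q'' = r i j" "reg ?s ''i'' = (if p < r i j then i else Suc (r i j))"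
    "reg ?s ''j'' = (if p < r i j then r i j else j)"
    using split by (simp_all add: descend_body_def p i_def j_def)
  have prep: "prepared n x ?s" using 3 run(1,2) by (simp add: prepared_def)
  have arr: "arr ?s ''split'' = arr s ''split''" using 3 run(1) by simp
  have "loop_free descend_body" by (simp add: descend_body_def)
  then show ?case
  proof (rule terminates_run)
    have "r i j \<noteq> p" using 3 split p by (simp add: i_def j_def)
    then consider "p < r i j" | "r i j < p" by linarith
    then show "(prepared n x ?s \<and> arr ?s ''split'' = arr s ''split'' \<and> reg ?s ''p'' = p \<and>
        reg ?s ''i'' \<le> p \<and> p < reg ?s ''j'' \<and> reg ?s ''j'' \<le> n \<and>
        (\<exists>ys. descent r 0 n p = ys @ descent r (reg ?s ''i'') (reg ?s ''j'') p \<and>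
           reg ?s ''q'' = (if ys = [] then p else last ys))) \<and>
        reg ?s ''j'' - reg ?s ''i'' < reg s' ''j'' - reg s' ''i''"
    proof cases
      case 1
      then have "descent r 0 n p = (ys @ [r i j]) @ descent r i (r i j) p"
        using ys descent_left[OF assms(2), of i p j] ij by simp
      then have "descent r 0 n p = (ys @ [r i j]) @ descent r (reg ?s ''i'') (reg ?s ''j'') p \<and>
          reg ?s ''q'' = (if ys @ [r i j] = [] then p else last (ys @ [r i j]))"
        using 1 run(4-6) by simp
      moreover have "reg ?s ''i'' \<le> p" "p < reg ?s ''j''" "reg ?s ''j'' \<le> n"
        "reg ?s ''j'' - reg ?s ''i'' < reg s' ''j'' - reg s' ''i''"
        using 1 run(4-6) ij r unfolding i_def[symmetric] j_def[symmetric] by simp_all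
      ultimately show ?thesis using prep arr run(3) by blast
    next
      case 2
      then have "descent r 0 n p = (ys @ [r i j]) @ descent r (Suc (r i j)) j p"
        using ys descent_right[OF assms(2), of i j p] ij by simp
      then have "descent r 0 n p = (ys @ [r i j]) @ descent r (reg ?s ''i'') (reg ?s ''j'') p \<and>
          reg ?s ''q'' = (if ys @ [r i j] = [] then p else last (ys @ [r i j]))"
        using 2 run(4-6) by simp
      moreover have "reg ?s ''i'' \<le> p" "p < reg ?s ''j''" "reg ?s ''j'' \<le> n"
        "reg ?s ''j'' - reg ?s ''i'' < reg s' ''j'' - reg s' ''i''"
        using 2 run(4-6) ij r unfolding i_def[symmetric] j_def[symmetric] by simp_all
      ultimately show ?thesis using prep arr run(3) by blast
    qed
  qed
next
  case (4 s')
  then obtain ys where ys: "descent r 0 n p = ys @ descent r (reg s' ''i'') (reg s' ''j'') p"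
    "reg s' ''q'' = (if ys = [] then p else last ys)" by auto
  have "r (reg s' ''i'') (reg s' ''j'') = p" using 4 assms(3) by (auto simp: prepared_def)
  \<comment> \<open>The rest of the search is now \<open>[p]\<close>, so \<open>ys\<close> is the
    whole search without its last entry, as in \<open>descent_parent\<close>.\<close>
  with ys show ?case by (auto simp: descent_parent_def descent_root Let_def)
qed (use assms in auto)

lemma terminates_parents:
  assumes "prepared n x s" "splits x n r" "r = (\<lambda>i j. arr s ''split'' (index n i j))"
    and "inj_on (arr s ''order'') {..<n}"
  shows "terminates n parents s (\<lambda>s'. \<forall>p<n.
    arr s' ''parent'' (arr s ''order'' p) = arr s ''order'' (descent_parent r n p))"
  unfolding parents_def
  apply (rule terminates_Seq, rule terminates_run, simp)
proof (rule terminates_While[where m = "\<lambda>s. n - reg s ''p''" and I = "\<lambda>s'.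
    prepared n x s' \<and> arr s' ''split'' = arr s ''split'' \<and> arr s' ''order'' = arr s ''order'' \<and>
    reg s' ''p'' \<le> n \<and> (\<forall>p<reg s' ''p''.
    arr s' ''parent'' (arr s ''order'' p) = arr s ''order'' (descent_parent r n p))"], goal_cases)
  case (3 s')
  show ?case unfolding parent_body_def
    apply (rule terminates_Seq, rule terminates_run, simp, rule terminates_Seq)
    apply (rule terminates_frame[OF terminates_descend[of n x _ r "reg s' ''p''"]])
            apply (use 3 assms in \<open>auto simp: prepared_def\<close>)[8]
    subgoal for s2
    proof (rule terminates_run, goal_cases)
      case 2
      define p where "p = reg s' ''p''"
      have p: "p < n" using 3 by (auto simp: p_def prepared_def)
      have s2: "arr s2 = arr s'" "reg s2 ''p'' = p" "reg s2 ''vertices'' = n"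
        "reg s2 ''q'' = descent_parent r n p"
        using 2 3 by (auto simp: p_def prepared_def descend_body_def fun_eq_iff)
      define t where "t = run (Seq (Write ''parent'' (Read ''order'' (Var ''p'')) (Read ''order'' (Var ''q'')))
         (increment ''p'')) s2"
      have run: "reg t ''p'' = Suc p" "reg t ''vertices'' = n"
        "arr t = (arr s')(''parent'' := (arr s' ''parent'')
           (arr s ''order'' p := arr s ''order'' (descent_parent r n p)))"
        using s2 3 by (simp_all add: t_def)
      have "arr t ''parent'' (arr s ''order'' a) = arr s ''order'' (descent_parent r n a)"
        if "a < Suc p" for a
      proof (cases "a = p")
        case False
        \<comment> \<open>Distinct positions carry distinct vertices, so the new write does not
          destroy an earlier parent.\<close>
        with that p assms(4) have "arr s ''order'' a \<noteq> arr s ''order'' p" by (auto simp: inj_on_def)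
        with False that 3 show ?thesis unfolding run by (auto simp: p_def)
      qed (simp only: run fun_upd_apply simp_thms if_True)
      moreover have "prepared n x t" using 3 run by (auto simp: prepared_def)
      moreover have "arr t ''split'' = arr s ''split''" "arr t ''order'' = arr s ''order''"
        using 3 run(3) by simp_all
      moreover have "Suc p \<le> n" "n - Suc p < n - reg s' ''p''" using p by (auto simp: p_def)
      ultimately show ?case unfolding t_def[symmetric] run(1) by blast
    qed simp
    done
qed (use assms in \<open>auto simp: prepared_def\<close>)


section \<open>Correctness\<close>


lemma path_treedepth_correct:
  assumes "path_graph {..<n} E" "edge_list es E"
  shows "terminates n path_treedepth (input n es w) (\<lambda>s. optimal_decomposition {..<n} E w (output_forest n s))"
proof -
  let ?s0 = "input n es w"
  obtain us where us: "traverses us E" "{..<n} = set us"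
    using assms(1) by (auto simp: path_graph_def traverses_def)
  have n: "length us = n"
    using us distinct_card[of us] by (simp add: traverses_def flip: us(2))
  then have "0 < n" using us(1) by (auto simp: traverses_def)
  have m: "length es \<le> n" using length_edge_list[OF assms(2) us(1)] n by simp
  have us0: "us ! 0 < n" using us(2) n \<open>0 < n\<close> by (metis lessThan_iff nth_mem)
  \<comment> \<open>The first vertex of \<open>us\<close> witnesses that a vertex of degree below 2
    exists; the program may settle on the other end.\<close>
  have deg0: "incident (\<lambda>_. 1) es (us ! 0) < 2"
    using incident_traverses[OF assms(2) us(1), of 0 "\<lambda>_. 1"] n \<open>0 < n\<close> by simp
  show ?thesis unfolding path_treedepth_def
  proof (rule terminates_Seq, rule terminates_frame[OF terminates_neighbours[of ?s0 es]], goal_cases)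
    case (8 s1)
    then have s1: "arr s1 ''sum'' = incident (\<lambda>u. u) es" "arr s1 ''degree'' = incident (\<lambda>_. 1) es"
      and r1: "\<And>x. x \<notin> {''e'', ''u'', ''v''} \<Longrightarrow> reg s1 x = reg ?s0 x"
      and a1: "\<And>A. A \<notin> {''sum'', ''degree''} \<Longrightarrow> arr s1 A = arr ?s0 A"
      by (auto simp: neighbours_def neighbours_body_def)
    show ?case
    proof (rule terminates_Seq, rule terminates_frame[OF terminates_endpoint[of s1 n "us ! 0"]], goal_cases)
      case (6 s2)
      then have cur: "reg s2 ''cur'' < n" "incident (\<lambda>_. 1) es (reg s2 ''cur'') < 2"
        and row: "\<forall>i\<le>n. arr s2 ''row'' i = i * (n + 1)"
        and r2: "\<And>x. x \<notin> {''cur'', ''i''} \<Longrightarrow> reg s2 x = reg s1 x"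
        and a2: "\<And>A. A \<noteq> ''row'' \<Longrightarrow> arr s2 A = arr s1 A"
        by (auto simp: s1 endpoint_def endpoint_body_def)
      have "reg s2 ''cur'' \<in> set us" using cur(1) us(2) by auto
      \<comment> \<open>The traversal is chosen afresh to start at the end that the program found;
        positions refer to \<open>vs\<close> from here on.\<close>
      then obtain vs where vs: "traverses vs E" "set vs = {..<n}" "length vs = n" "vs ! 0 = reg s2 ''cur''"
        using obtain_traversal_from[OF assms(2) us(1) _ cur(2)] us(2) n by metis
      show ?case
      proof (rule terminates_Seq, rule terminates_frame[OF terminates_walk[OF assms(2) vs(1,3), of s2]], goal_cases)
        case (6 s3)
        then have order: "\<forall>p<n. arr s3 ''order'' p = vs ! p"
          and r3: "\<And>x. x \<notin> {''p'', ''q'', ''prev'', ''cur''} \<Longrightarrow> reg s3 x = reg s2 x"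
          and a3: "\<And>A. A \<noteq> ''order'' \<Longrightarrow> arr s3 A = arr s2 A"
          by (auto simp: walk_def walk_body_def)
        have V: "vs ! p < n" if "p < n" for p using vs(2,3) that by (metis lessThan_iff nth_mem)
        have "arr s3 ''weight'' = load (map w [0..<n])"
          by (simp add: a1 a2 a3 input_def)
        then have prep: "prepared n (\<lambda>p. w (vs ! p)) s3"
          using row order V by (auto simp: prepared_def r1 r2 r3 a3 input_def index_def load_def)
        show ?case
        proof (rule terminates_Seq, rule terminates_frame[OF terminates_table[OF prep]], goal_cases)
          case (3 s4)
          let ?r = "\<lambda>i j. arr s4 ''split'' (index n i j)"
          have r4: "reg s4 ''vertices'' = reg s3 ''vertices''"
            and a4: "\<And>A. A \<noteq> ''depth'' \<Longrightarrow> A \<noteq> ''split'' \<Longrightarrow> arr s4 A = arr s3 A"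
            using 3 by (auto simp: table_def length_body_def interval_body_def min_body_def)
          have "prepared n (\<lambda>p. w (vs ! p)) s4" using prep by (simp add: prepared_def r4 a4)
          moreover have "inj_on (arr s4 ''order'') {..<n}"
            using order vs(1,3) by (auto simp: a4 inj_on_def traverses_def nth_eq_iff_index_eq)
          ultimately show ?case
          proof (rule terminates_mono[OF terminates_parents[OF _ 3(1) refl]])
            fix s :: state assume "\<forall>p<n. arr s ''parent'' (arr s4 ''order'' p) =
              arr s4 ''order'' (descent_parent ?r n p)"
            then have parent: "arr s ''parent'' (vs ! p) = vs ! descent_parent ?r n p" if "p < n" for p
              using order that descent_parent_less[OF 3(1)] by (simp add: a4)
            show "optimal_decomposition {..<n} E w (output_forest n s)"
            proof (rule optimal_decomposition_descent[OF _ _ _ _ _ 3(1)])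
              fix p assume p: "p < n"
              then have "descent_parent ?r n p < n"
                by (rule descent_parent_less[OF 3(1)])
              with p show "output_forest n s (vs ! p) =
                (if descent_parent ?r n p = p then None else Some (vs ! descent_parent ?r n p))"
                using V parent vs(1,3) by (auto simp: output_forest_def traverses_def nth_eq_iff_index_eq)
            next
              show "dom (output_forest n s) \<subseteq> {..<n}"
                by (auto simp: output_forest_def split: if_splits)
            qed (use vs in \<open>simp_all add: traverses_def\<close>)
          qed
        qed (use \<open>0 < n\<close> in \<open>simp_all add: r1 r2 r3 a1 a2 a3 input_def\<close>)
      qed (use vs(4) in \<open>simp_all add: s1 r1 r2 a1 a2 input_def\<close>)
    qed (use us0 deg0 in \<open>simp_all add: s1 r1 a1 input_def\<close>)
  qed (use m in \<open>simp_all add: input_def load_def\<close>)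
qed

theorem theorem2:
  shows "\<exists>(prog :: com) (T :: nat \<Rightarrow> nat).
    (\<lambda>n. real (T n)) \<in> O(\<lambda>n. real n ^ 3) \<and>
    (\<forall>(n :: nat) (E :: nat set set) (es :: (nat \<times> nat) list) (w :: nat \<Rightarrow> nat).
       path_graph {..<n} E \<longrightarrow> edge_list es E \<longrightarrow> (\<forall>v<n. w v > 0) \<longrightarrow>
       (\<exists>t s. exec prog (input n es w) t s \<and> t \<le> T n \<and>
              optimal_decomposition {..<n} E w (output_forest n s)))"
  using time_bound_path_treedepth path_treedepth_correct
  by (intro exI[of _ path_treedepth] exI[of _ "\<lambda>n. time_bound n path_treedepth"])
     (auto simp: terminates_def)

end
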